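(* Suppose similar hyperbolic $A,B\in\mathrm{GL}(n,\mathbb{Z})$ are irreducible. Then for any topological $R$-module isomorphism $\Psi:G_A\to G_B$, either $\Psi\big(\iota_A(\mathbb{Z}^n)\big)\cap\iota_B(\mathbb{Z}^n)=\{0\}$ or $\Psi\big(\iota_A(\mathbb{Z}^n)\big)\cap\iota_B(\mathbb{Z}^n)$ has finite index in $\iota_B(\mathbb{Z}^n)$.
   Context: A matrix in $\mathrm{GL}(n,\mathbb{Z})$ is hyperbolic if it has no eigenvalue of modulus $1$, and irreducible if its characteristic polynomial is irreducible. Matrices $A,B\in\mathrm{GL}(n,\mathbb{Z})$ are similar if there is $C\in\mathrm{GL}(n,\mathbb{Q})$ with $AC=CB$. For similar irreducible $A,B$ with common characteristic polynomial $p(x)$, let $R=\mathbb{Z}[x]/(p(x))$, so that $R\cong\mathbb{Z}[A]\cong\mathbb{Z}[B]$ as rings via $x\mapsto A$ and $x\mapsto B$. Regard $\mathbb{Z}^n$ as row vectors, with $A$ acting on the right by $m\mapsto mA$. For $k\in\mathbb{N}=\{1,2,\dots\}$ set $N_{k,A}=\mathbb{Z}^n(A^{k!}-I)$ and $G_{k,A}=\mathbb{Z}^n/N_{k,A}$, a finite group with elements $[m]_{k,A}=m+N_{k,A}$, given the discrete topology and the $R$-module structure in which $x$ acts by $[m]_{k,A}\mapsto[mA]_{k,A}$. For $l\le k$ one has $N_{k,A}\le N_{l,A}$, and there is the canonical epimorphism $\varphi_{k,l,A}:G_{k,A}\to G_{l,A}$, $[m]_{k,A}\mapsto[m]_{l,A}$.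 The profinite $R$-module $G_A$ is the inverse limit $\varprojlim_{k\in\mathbb{N}}G_{k,A}\le\prod_{k\in\mathbb{N}}G_{k,A}$ of this inverse system, with the topology induced by the product topology, and with $x$ acting by $\Gamma_A(\{[m_k]_{k,A}\}_{k})=\{[m_kA]_{k,A}\}_{k}$. The canonical homomorphism $\iota_A:\mathbb{Z}^n\to G_A$ is $\iota_A(m)=\{[m]_{k,A}\}_{k\in\mathbb{N}}$. The module $G_B$ and the map $\iota_B$ are defined in the same way from $B$, with $x$ acting through $B$. A topological $R$-module isomorphism is an $R$-module isomorphism that is also a homeomorphism. *)

theory Defs
  imports
    "HOL-Analysis.Function_Topology"
    "HOL-Algebra.QuotRing"
    "Jordan_Normal_Form.Char_Poly"
    "Jordan_Normal_Form.VS_Connect"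
begin

hide_const (open) Multiset.mult Polynomial.smult Modules.module

section \<open>Integer matrices\<close>

text \<open>Invertibility of an integer matrix means having an inverse over the integers.\<close>
definition GL_int :: "nat \<Rightarrow> int mat set" where
  "GL_int n = {A \<in> carrier_mat n n. invertible_mat A}"

definition GL_rat :: "nat \<Rightarrow> rat mat set" where
  "GL_rat n = {C \<in> carrier_mat n n. invertible_mat C}"

definition hyperbolic_mat :: "int mat \<Rightarrow> bool" where
  "hyperbolic_mat A \<longleftrightarrow>
     (\<forall>z::complex. eigenvalue (map_mat complex_of_int A) z \<longrightarrow> cmod z \<noteq> 1)"

text \<open>Irreducibility is meant in \<open>\<int>[x]\<close>; as \<^term>\<open>char_poly A\<close> is monic, this is the same as
  irreducibility over the rationals.\<close>
definition irreducible_mat :: "int mat \<Rightarrow> bool" where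
  "irreducible_mat A \<longleftrightarrow> Factorial_Ring.irreducible (char_poly A)"

definition rat_similar :: "nat \<Rightarrow> int mat \<Rightarrow> int mat \<Rightarrow> bool" where
  "rat_similar n A B \<longleftrightarrow>
     (\<exists>C \<in> GL_rat n. map_mat rat_of_int A * C = C * map_mat rat_of_int B)"

definition row_mult :: "int vec \<Rightarrow> int mat \<Rightarrow> int vec" (infixl \<open>\<^sub>r*\<close> 70) where
  "m \<^sub>r* A = Matrix.vec (dim_col A) (\<lambda>j. m \<bullet> col A j)"

definition poly_mat :: "int poly \<Rightarrow> int mat \<Rightarrow> int mat" where
  "poly_mat f A = Matrix.mat (dim_row A) (dim_row A)
     (\<lambda>ij. \<Sum>d\<le>degree f. coeff f d * (A ^\<^sub>m d) $$ ij)"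


section \<open>The ring \<open>\<int>[x]/(p)\<close> and the finite quotients\<close>

definition quot_poly_ring :: "int poly \<Rightarrow> int poly set ring" where
  "quot_poly_ring p =
     (class_ring :: int poly ring) Quot (PIdl\<^bsub>(class_ring :: int poly ring)\<^esub> p)"

abbreviation Z_vec :: "int mat \<Rightarrow> (int, int vec) module" where
  "Z_vec A \<equiv> module_vec TYPE(int) (dim_row A)"

definition N_sub :: "nat \<Rightarrow> int mat \<Rightarrow> int vec set" where
  "N_sub k A = (\<lambda>m. m \<^sub>r* (A ^\<^sub>m fact k - 1\<^sub>m (dim_row A))) ` carrier (Z_vec A)"

definition coset_of :: "nat \<Rightarrow> int mat \<Rightarrow> int vec \<Rightarrow> int vec set" where
  "coset_of k A m = N_sub k A +>\<^bsub>Z_vec A\<^esub> m"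

text \<open>Scalars are the cosets \<open>q = f + (p)\<close>, acting by \<open>[m] \<mapsto> [m f(A)]\<close>. As with the multiplication
  of \<^const>\<open>FactRing\<close>, the choice of representatives is avoided by taking the union over all of
  them: if \<open>p\<close> is the characteristic polynomial of \<open>A\<close>, all the cosets in the union coincide.
  The fields \<^const>\<open>mult\<close> and \<^const>\<open>one\<close> play no role in a module.\<close>
definition G_fin :: "nat \<Rightarrow> int mat \<Rightarrow> (int poly set, int vec set) module" where
  "G_fin k A = \<lparr>
     carrier = a_rcosets\<^bsub>Z_vec A\<^esub> N_sub k A,
     mult = undefined,
     one = undefined,
     zero = N_sub k A,
     add = (\<lambda>c d. c <+>\<^bsub>Z_vec A\<^esub> d),
     smult = (\<lambda>q c. \<Union>f\<in>q. \<Union>m\<in>c. coset_of k A (m \<^sub>r* poly_mat f A))\<rparr>"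

text \<open>The map \<open>[m]\<^sub>k \<mapsto> [m]\<^sub>l\<close>, meaningful for \<open>l \<le> k\<close>.\<close>
definition transition :: "nat \<Rightarrow> nat \<Rightarrow> int mat \<Rightarrow> int vec set \<Rightarrow> int vec set" where
  "transition k l A c = (\<Union>m\<in>c. coset_of l A m)"


section \<open>The profinite module\<close>

definition G_lim :: "int mat \<Rightarrow> (int poly set, nat \<Rightarrow> int vec set) module" where
  "G_lim A = \<lparr>
     carrier = {g \<in> (\<Pi>\<^sub>E k\<in>{1..}. carrier (G_fin k A)).
                  \<forall>k l. 1 \<le> l \<and> l \<le> k \<longrightarrow> transition k l A (g k) = g l},
     mult = undefined,
     one = undefined,
     zero = (\<lambda>k\<in>{1..}. \<zero>\<^bsub>G_fin k A\<^esub>),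
     add = (\<lambda>g h. \<lambda>k\<in>{1..}. g k \<oplus>\<^bsub>G_fin k A\<^esub> h k),
     smult = (\<lambda>q g. \<lambda>k\<in>{1..}. q \<odot>\<^bsub>G_fin k A\<^esub> g k)\<rparr>"

definition G_top :: "int mat \<Rightarrow> (nat \<Rightarrow> int vec set) topology" where
  "G_top A = subtopology
     (product_topology (\<lambda>k. discrete_topology (carrier (G_fin k A))) {1..})
     (carrier (G_lim A))"

definition iota :: "int mat \<Rightarrow> int vec \<Rightarrow> (nat \<Rightarrow> int vec set)" where
  "iota A m = (\<lambda>k\<in>{1..}. coset_of k A m)"

definition iota_image :: "int mat \<Rightarrow> (nat \<Rightarrow> int vec set) set" where
  "iota_image A = iota A ` carrier (Z_vec A)"

definition top_module_iso ::
  "('r, 'x) ring_scheme \<Rightarrow> ('r, 'a, 'y) module_scheme \<Rightarrow> 'a topology \<Rightarrow>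
   ('r, 'b, 'z) module_scheme \<Rightarrow> 'b topology \<Rightarrow> ('a \<Rightarrow> 'b) \<Rightarrow> bool"
where
  "top_module_iso R M S N T \<Psi> \<longleftrightarrow>
     \<Psi> \<in> LinearCombinations.module_hom R M N \<and>
     bij_betw \<Psi> (carrier M) (carrier N) \<and>
     homeomorphic_map S T \<Psi>"

text \<open>The index of \<open>H\<close> in \<open>K\<close> is finite, for additive subgroups \<open>H \<subseteq> K\<close> of \<open>M\<close>.\<close>
definition finite_index :: "('a, 'b, 'c) module_scheme \<Rightarrow> 'b set \<Rightarrow> 'b set \<Rightarrow> bool" where
  "finite_index M H K \<longleftrightarrow> finite (a_rcosets\<^bsub>M\<lparr>carrier := K\<rparr>\<^esub> H)"

end

theory Submission
  imports Defs
begin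

text \<open>
  The intersection \<open>H = \<Psi>(\<iota>\<^sub>A(\<int>\<^sup>n)) \<inter> \<iota>\<^sub>B(\<int>\<^sup>n)\<close> is an \<open>R\<close>-submodule of \<open>\<iota>\<^sub>B(\<int>\<^sup>n)\<close>, because both
  images are \<open>R\<close>-submodules and \<open>\<Psi>\<close> is \<open>R\<close>-linear. If \<open>H\<close> is not zero, it contains some \<open>\<iota>\<^sub>B(m)\<close>
  with \<open>m \<noteq> 0\<close>, hence \<open>\<iota>\<^sub>B(m f(B))\<close> for every \<open>f \<in> \<int>[x]\<close>. Irreducibility of the characteristic
  polynomial makes \<open>m, mB, \<dots>, mB\<^sup>n\<^sup>-\<^sup>1\<close> linearly independent: a relation would be a nonzero polynomial of
  degree less than \<open>n\<close> that annihilates \<open>m\<close>. So the cyclic module \<open>m \<int>[B]\<close> is a full lattice in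
  \<open>\<int>\<^sup>n\<close>; with \<open>d\<close> the absolute value of the determinant of these \<open>n\<close> rows it contains \<open>d\<int>\<^sup>n\<close>
  (lemma \<open>cyclic_submodule_contains_multiples\<close>). Thus \<open>H\<close> contains \<open>\<iota>\<^sub>B(d\<int>\<^sup>n)\<close>, and a coset of \<open>H\<close>
  in \<open>\<iota>\<^sub>B(\<int>\<^sup>n)\<close> is determined by a vector modulo \<open>d\<close>, which leaves finitely many cosets
  (lemma \<open>finite_index_if_contains_multiples\<close>).

  For this argument the scalar \<open>f + (p)\<close> has to act on \<open>\<iota>\<^sub>A(m)\<close> as \<open>f(A)\<close>, and likewise for \<open>B\<close>, with
  \<open>p\<close> the characteristic polynomial of \<open>A\<close>. That needs \<open>p(A) = 0\<close> and \<open>p(B) = 0\<close>: the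
  Cayley--Hamilton theorem, together with the fact that similar matrices have the same characteristic
  polynomial.
\<close>

section \<open>Row vectors times matrices\<close>

lemma row_mult_eq_transpose:
  "A \<in> carrier_mat n n \<Longrightarrow> m \<in> carrier_vec n \<Longrightarrow> m \<^sub>r* A = transpose_mat A *\<^sub>v m"
  unfolding row_mult_def
  by (intro eq_vecI) (auto simp: comm_scalar_prod[of _ n])

lemma row_mult_carrier [simp]:
  "A \<in> carrier_mat n n \<Longrightarrow> m \<^sub>r* A \<in> carrier_vec n"
  unfolding row_mult_def by auto

lemma row_mult_assoc:
  assumes "m \<in> carrier_vec n" "A \<in> carrier_mat n n" "B \<in> carrier_mat n n"
  shows "(m \<^sub>r* A) \<^sub>r* B = m \<^sub>r* (A * B)"
  using assms
  by (simp add: row_mult_eq_transpose[of _ n] transpose_mult assoc_mult_mat_vec[of _ n n _ n])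

lemma row_mult_add_left:
  assumes "m \<in> carrier_vec n" "m' \<in> carrier_vec n" "A \<in> carrier_mat n n"
  shows "(m + m') \<^sub>r* A = m \<^sub>r* A + m' \<^sub>r* A"
  using assms
  by (simp add: row_mult_eq_transpose[of _ n] mult_add_distrib_mat_vec[of _ n n])

lemma row_mult_diff_left:
  assumes "m \<in> carrier_vec n" "m' \<in> carrier_vec n" "A \<in> carrier_mat n n"
  shows "(m - m') \<^sub>r* A = m \<^sub>r* A - m' \<^sub>r* A"
  using assms unfolding row_mult_def
  by (intro eq_vecI) (auto simp: minus_scalar_prod_distrib[of _ n])

lemma row_mult_smult_left:
  assumes "m \<in> carrier_vec n" "A \<in> carrier_mat n n"
  shows "(c \<cdot>\<^sub>v m) \<^sub>r* A = c \<cdot>\<^sub>v (m \<^sub>r* A)"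
  using assms unfolding row_mult_def by (intro eq_vecI) auto

lemma row_mult_add_right:
  assumes "m \<in> carrier_vec n" "A \<in> carrier_mat n n" "B \<in> carrier_mat n n"
  shows "m \<^sub>r* (A + B) = m \<^sub>r* A + m \<^sub>r* B"
  using assms
  by (simp add: row_mult_eq_transpose[of _ n] transpose_add add_mult_distrib_mat_vec[of _ n n])

lemma row_mult_zero_right [simp]:
  "m \<in> carrier_vec n \<Longrightarrow> m \<^sub>r* 0\<^sub>m n n = 0\<^sub>v n"
  unfolding row_mult_def by (intro eq_vecI) auto

lemma row_mult_zero_left [simp]:
  "A \<in> carrier_mat n n \<Longrightarrow> 0\<^sub>v n \<^sub>r* A = 0\<^sub>v n"
  unfolding row_mult_def by (intro eq_vecI) (auto simp: scalar_prod_def)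

lemma row_mult_smult_one:
  "m \<in> carrier_vec n \<Longrightarrow> m \<^sub>r* (c \<cdot>\<^sub>m 1\<^sub>m n) = c \<cdot>\<^sub>v m"
  unfolding row_mult_def by (intro eq_vecI) (auto simp: scalar_prod_def if_distrib cong: if_cong)

section \<open>Evaluating integer polynomials at a matrix\<close>

lemma poly_mat_carrier [simp]: "A \<in> carrier_mat n n \<Longrightarrow> poly_mat f A \<in> carrier_mat n n"
  unfolding poly_mat_def by auto

lemma poly_mat_dim [simp]: "dim_row (poly_mat f A) = dim_row A" "dim_col (poly_mat f A) = dim_row A"
  unfolding poly_mat_def by auto

lemma poly_mat_index:
  assumes "A \<in> carrier_mat n n" "i < n" "j < n" "degree f \<le> N"
  shows "poly_mat f A $$ (i, j) = (\<Sum>d\<le>N. coeff f d * (A ^\<^sub>m d) $$ (i, j))"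
proof -
  have "(\<Sum>d\<le>N. coeff f d * (A ^\<^sub>m d) $$ (i, j)) = (\<Sum>d\<le>degree f. coeff f d * (A ^\<^sub>m d) $$ (i, j))"
    using assms(4) by (intro sum.mono_neutral_right) (auto simp: coeff_eq_0)
  thus ?thesis using assms by (simp add: poly_mat_def)
qed

lemma poly_mat_0 [simp]: "A \<in> carrier_mat n n \<Longrightarrow> poly_mat 0 A = 0\<^sub>m n n"
  by (intro eq_matI) (auto simp: poly_mat_def)

lemma poly_mat_add:
  assumes A: "A \<in> carrier_mat n n"
  shows "poly_mat (f + g) A = poly_mat f A + poly_mat g A"
proof (intro eq_matI)
  fix i j assume "i < dim_row (poly_mat f A + poly_mat g A)" "j < dim_col (poly_mat f A + poly_mat g A)"
  hence ij: "i < n" "j < n" using poly_mat_carrier[OF A, of g] by auto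
  let ?N = "max (degree f) (degree g)"
  show "poly_mat (f + g) A $$ (i, j) = (poly_mat f A + poly_mat g A) $$ (i, j)"
    using ij A
    by (simp add: poly_mat_index[OF A ij, of _ ?N] degree_add_le_max sum.distrib distrib_right)
qed (insert A, auto)

lemma poly_mat_pCons:
  assumes A: "A \<in> carrier_mat n n"
  shows "poly_mat (pCons a f) A = a \<cdot>\<^sub>m 1\<^sub>m n + poly_mat f A * A"
proof (intro eq_matI)
  fix i j assume "i < dim_row (a \<cdot>\<^sub>m 1\<^sub>m n + poly_mat f A * A)" "j < dim_col (a \<cdot>\<^sub>m 1\<^sub>m n + poly_mat f A * A)"
  hence ij: "i < n" "j < n" using A by auto
  have car: "poly_mat f A \<in> carrier_mat n n" "\<And>d. A ^\<^sub>m d \<in> carrier_mat n n" using A by auto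
  have "(poly_mat f A * A) $$ (i, j) = (\<Sum>k<n. poly_mat f A $$ (i, k) * A $$ (k, j))"
    using ij A car by (auto simp: scalar_prod_def atLeast0LessThan)
  also have "\<dots> = (\<Sum>k<n. \<Sum>d\<le>degree f. coeff f d * ((A ^\<^sub>m d) $$ (i, k) * A $$ (k, j)))"
    by (intro sum.cong) (auto simp: poly_mat_index[OF A ij(1) _ order_refl] sum_distrib_right mult.assoc)
  also have "\<dots> = (\<Sum>d\<le>degree f. coeff f d * (\<Sum>k<n. (A ^\<^sub>m d) $$ (i, k) * A $$ (k, j)))"
    by (subst sum.swap) (simp add: sum_distrib_left)
  also have "\<dots> = (\<Sum>d\<le>degree f. coeff f d * (A ^\<^sub>m (Suc d)) $$ (i, j))"
  proof (intro sum.cong refl arg_cong2[where f = "(*)"])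
    fix d
    show "(\<Sum>k<n. (A ^\<^sub>m d) $$ (i, k) * A $$ (k, j)) = (A ^\<^sub>m (Suc d)) $$ (i, j)"
      using ij A car(2)[of d] by (auto simp: scalar_prod_def atLeast0LessThan)
  qed
  finally have "(a \<cdot>\<^sub>m 1\<^sub>m n + poly_mat f A * A) $$ (i, j)
      = a * (A ^\<^sub>m 0) $$ (i, j) + (\<Sum>d\<le>degree f. coeff f d * (A ^\<^sub>m (Suc d)) $$ (i, j))"
    using ij A car by auto
  also have "\<dots> = (\<Sum>d\<le>Suc (degree f). coeff (pCons a f) d * (A ^\<^sub>m d) $$ (i, j))"
    by (simp only: sum.atMost_Suc_shift coeff_pCons_0 coeff_pCons_Suc)
  also have "\<dots> = poly_mat (pCons a f) A $$ (i, j)"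
    by (rule poly_mat_index[OF A ij, symmetric]) (simp add: degree_pCons_le)
  finally show "poly_mat (pCons a f) A $$ (i, j) = (a \<cdot>\<^sub>m 1\<^sub>m n + poly_mat f A * A) $$ (i, j)" ..
qed (insert A, auto)

lemma poly_mat_pCons_0:
  "A \<in> carrier_mat n n \<Longrightarrow> poly_mat (pCons 0 f) A = poly_mat f A * A"
  by (intro eq_matI) (auto simp: poly_mat_pCons)

lemma poly_mat_const:
  "A \<in> carrier_mat n n \<Longrightarrow> poly_mat [:a:] A = a \<cdot>\<^sub>m 1\<^sub>m n"
  by (intro eq_matI) (auto simp: poly_mat_pCons)

lemma poly_mat_X:
  assumes A: "A \<in> carrier_mat n n"
  shows "poly_mat [:0, 1:] A = A"
proof -
  have "1 \<cdot>\<^sub>m 1\<^sub>m n = (1\<^sub>m n :: int mat)" by (intro eq_matI) auto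
  thus ?thesis using A by (simp add: poly_mat_pCons_0 poly_mat_const)
qed

lemma poly_mat_commute:
  assumes A: "A \<in> carrier_mat n n"
  shows "A * poly_mat f A = poly_mat f A * A"
proof (induction f)
  case 0
  show ?case using A by simp
next
  case (pCons a f)
  have "A * (poly_mat f A * A) = poly_mat f A * A * A"
    using assoc_mult_mat[OF A poly_mat_carrier[OF A, of f] A] pCons by simp
  moreover have car: "poly_mat f A * A \<in> carrier_mat n n" "a \<cdot>\<^sub>m 1\<^sub>m n \<in> carrier_mat n n" using A by auto
  ultimately show ?case
    using mult_add_distrib_mat[OF A car(2,1)] add_mult_distrib_mat[OF car(2,1) A] A
    by (simp add: poly_mat_pCons mult_smult_distrib[of _ n n _ n] mult_smult_assoc_mat[of _ n n _ n])
qed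

lemma poly_mat_smult:
  assumes A: "A \<in> carrier_mat n n"
  shows "poly_mat (Polynomial.smult a f) A = a \<cdot>\<^sub>m poly_mat f A"
proof (intro eq_matI)
  fix i j assume "i < dim_row (a \<cdot>\<^sub>m poly_mat f A)" "j < dim_col (a \<cdot>\<^sub>m poly_mat f A)"
  hence ij: "i < n" "j < n" using A by auto
  show "poly_mat (Polynomial.smult a f) A $$ (i, j) = (a \<cdot>\<^sub>m poly_mat f A) $$ (i, j)"
    using ij A
    by (simp add: poly_mat_index[OF A ij, of _ "degree f"] degree_smult_le sum_distrib_left mult.assoc)
qed (insert A, auto)

lemma poly_mat_mult:
  assumes A: "A \<in> carrier_mat n n"
  shows "poly_mat (f * g) A = poly_mat f A * poly_mat g A"
proof (induction f)
  case 0
  show ?case using A left_mult_zero_mat[OF poly_mat_carrier[OF A, of g], of n] by simp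
next
  case (pCons a f)
  note car = poly_mat_carrier[OF A]
  have "poly_mat (pCons a f * g) A = a \<cdot>\<^sub>m poly_mat g A + poly_mat f A * poly_mat g A * A"
    using A by (simp add: poly_mat_add poly_mat_smult poly_mat_pCons_0 pCons)
  also have "poly_mat f A * poly_mat g A * A = poly_mat f A * A * poly_mat g A"
    using assoc_mult_mat[OF car[of f] A car[of g]] assoc_mult_mat[OF car[of f] car[of g] A]
    by (simp add: poly_mat_commute[OF A])
  also have "a \<cdot>\<^sub>m poly_mat g A + poly_mat f A * A * poly_mat g A = poly_mat (pCons a f) A * poly_mat g A"
    using A add_mult_distrib_mat[OF _ mult_carrier_mat[OF car[of f] A] car[of g], of "a \<cdot>\<^sub>m 1\<^sub>m n"]
    by (simp add: poly_mat_pCons mult_smult_assoc_mat[OF one_carrier_mat car[of g]] left_mult_one_mat[OF car])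
  finally show ?case .
qed

lemma poly_mat_sum_index:
  assumes A: "A \<in> carrier_mat n n" and "i < n" "j < n" and "finite I"
  shows "poly_mat (\<Sum>k\<in>I. f k) A $$ (i, j) = (\<Sum>k\<in>I. poly_mat (f k) A $$ (i, j))"
  using \<open>finite I\<close>
proof induction
  case empty
  thus ?case using assms by simp
next
  case (insert x F)
  then show ?case using assms poly_mat_carrier[OF A, of "sum f F"] by (simp add: poly_mat_add[OF A])
qed

lemma poly_mat_monom_minus_one:
  assumes A: "A \<in> carrier_mat n n"
  shows "poly_mat (Polynomial.monom 1 e - 1) A = A ^\<^sub>m e - 1\<^sub>m n"
proof (intro eq_matI)
  fix i j assume "i < dim_row (A ^\<^sub>m e - 1\<^sub>m n)" "j < dim_col (A ^\<^sub>m e - 1\<^sub>m n)"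
  hence ij: "i < n" "j < n" using A by auto
  have "poly_mat (Polynomial.monom 1 e - 1) A $$ (i, j) =
      (\<Sum>d\<le>e. coeff (Polynomial.monom 1 e - 1) d * (A ^\<^sub>m d) $$ (i, j))"
    by (rule poly_mat_index[OF A ij]) (simp add: degree_diff_le degree_monom_le)
  also have "\<dots> = (\<Sum>d\<le>e. if d = e then (A ^\<^sub>m d) $$ (i, j) else 0)
      - (\<Sum>d\<le>e. if d = 0 then (A ^\<^sub>m d) $$ (i, j) else 0)"
    by (subst sum_subtractf[symmetric], intro sum.cong) (auto simp: coeff_1)
  also have "\<dots> = (A ^\<^sub>m e - 1\<^sub>m n) $$ (i, j)" using ij A by simp
  finally show "poly_mat (Polynomial.monom 1 e - 1) A $$ (i, j) = (A ^\<^sub>m e - 1\<^sub>m n) $$ (i, j)" .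
qed (insert A, auto)

text \<open>Let \<open>x\<close> act on row vectors through \<open>A\<close>. With \<open>K = xI - A\<close>, the unit vectors satisfy the
  relations \<open>\<Sum>\<^sub>j e\<^sub>j K\<^sub>i\<^sub>j(A) = 0\<close>. Multiplying them by the adjugate of \<open>K\<close>, whose product with \<open>K\<close> is
  \<open>p I\<close>, gives \<open>e\<^sub>l p(A) = 0\<close> for every \<open>l\<close>.\<close>
theorem cayley_hamilton:
  assumes A: "A \<in> carrier_mat n n"
  shows "poly_mat (char_poly A) A = 0\<^sub>m n n"
proof -
  let ?K = "char_poly_matrix A" and ?D = "adj_mat (char_poly_matrix A)" and ?p = "char_poly A"
  have K: "?K \<in> carrier_mat n n" using A by simp
  note D = adj_mat(1)[OF K] and DK = adj_mat(3)[OF K]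
  have K_ij: "?K $$ (i, j) = (if i = j then [:0, 1:] else 0) + [:- A $$ (i, j):]" if "i < n" "j < n" for i j
    using A that by (auto simp: char_poly_matrix_def)
  have p_ij: "(\<Sum>k<n. ?K $$ (k, j) * ?D $$ (i, k)) = (if i = j then ?p else 0)" if "i < n" "j < n" for i j
  proof -
    have "(?D * ?K) $$ (i, j) = (\<Sum>k<n. ?K $$ (k, j) * ?D $$ (i, k))"
      using that K D by (auto simp: scalar_prod_def atLeast0LessThan mult.commute)
    moreover have "(?D * ?K) $$ (i, j) = (if i = j then ?p else 0)"
      unfolding DK using that by (simp add: char_poly_def)
    ultimately show ?thesis by simp
  qed
  \<comment> \<open>Row \<open>j\<close> of \<open>f(A)\<close> is \<open>e\<^sub>j f(A)\<close>, so this is the relation \<open>\<Sum>\<^sub>j e\<^sub>j K\<^sub>i\<^sub>j(A) = 0\<close> read off in column \<open>c\<close>.\<close>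
  have relation: "(\<Sum>j<n. poly_mat (?K $$ (i, j)) A $$ (j, c)) = 0" if i: "i < n" and c: "c < n" for i c
  proof -
    have "(\<Sum>j<n. poly_mat (?K $$ (i, j)) A $$ (j, c))
        = (\<Sum>j<n. (if i = j then A $$ (j, c) else 0) - (if j = c then A $$ (i, j) else 0))"
    proof (intro sum.cong refl)
      fix j assume "j \<in> {..<n}"
      hence j: "j < n" by simp
      have "poly_mat (?K $$ (i, j)) A $$ (j, c)
          = (if i = j then poly_mat [:0, 1:] A else 0\<^sub>m n n) $$ (j, c) + poly_mat [:- A $$ (i, j):] A $$ (j, c)"
        unfolding K_ij[OF i j] poly_mat_add[OF A] using A j c by (cases "i = j") simp_all
      thus "poly_mat (?K $$ (i, j)) A $$ (j, c)
          = (if i = j then A $$ (j, c) else 0) - (if j = c then A $$ (i, j) else 0)"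
        using j c unfolding poly_mat_X[OF A] poly_mat_const[OF A] by auto
    qed
    also have "\<dots> = 0" using i c by (simp add: sum_subtractf)
    finally show ?thesis .
  qed
  show ?thesis
  proof (intro eq_matI)
    fix l c assume "l < dim_row (0\<^sub>m n n :: int mat)" "c < dim_col (0\<^sub>m n n :: int mat)"
    hence l: "l < n" and c: "c < n" by auto
    have "poly_mat ?p A $$ (l, c) = (\<Sum>j<n. if l = j then poly_mat ?p A $$ (j, c) else 0)"
      using l by simp
    also have "\<dots> = (\<Sum>j<n. poly_mat (\<Sum>k<n. ?K $$ (k, j) * ?D $$ (l, k)) A $$ (j, c))"
      using A l c by (intro sum.cong) (auto simp: p_ij)
    also have "\<dots> = (\<Sum>j<n. \<Sum>k<n. \<Sum>b<n. poly_mat (?K $$ (k, j)) A $$ (j, b) * poly_mat (?D $$ (l, k)) A $$ (b, c))"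
    proof (intro sum.cong refl)
      fix j assume "j \<in> {..<n}"
      hence j: "j < n" by simp
      have "poly_mat (?K $$ (k, j) * ?D $$ (l, k)) A $$ (j, c)
          = (\<Sum>b<n. poly_mat (?K $$ (k, j)) A $$ (j, b) * poly_mat (?D $$ (l, k)) A $$ (b, c))" for k
        using j c poly_mat_carrier[OF A, of "?K $$ (k, j)"] poly_mat_carrier[OF A, of "?D $$ (l, k)"]
        by (auto simp: poly_mat_mult[OF A] scalar_prod_def atLeast0LessThan)
      thus "poly_mat (\<Sum>k<n. ?K $$ (k, j) * ?D $$ (l, k)) A $$ (j, c)
        = (\<Sum>k<n. \<Sum>b<n. poly_mat (?K $$ (k, j)) A $$ (j, b) * poly_mat (?D $$ (l, k)) A $$ (b, c))"
        using j c by (simp add: poly_mat_sum_index[OF A])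
    qed
    also have "\<dots> = (\<Sum>k<n. \<Sum>b<n. (\<Sum>j<n. poly_mat (?K $$ (k, j)) A $$ (j, b)) * poly_mat (?D $$ (l, k)) A $$ (b, c))"
      by (subst sum.swap, rule sum.cong[OF refl], subst sum.swap, simp add: sum_distrib_right)
    also have "\<dots> = 0" by (simp add: relation)
    finally show "poly_mat ?p A $$ (l, c) = 0\<^sub>m n n $$ (l, c)" using l c by simp
  qed (insert A, auto)
qed

text \<open>Similar rational matrices have equal characteristic polynomials, and \<open>\<int>[x]\<close> embeds in
  \<open>\<rat>[x]\<close>.\<close>
lemma char_poly_eq_if_rat_similar:
  assumes A: "A \<in> carrier_mat n n" and B: "B \<in> carrier_mat n n" and sim: "rat_similar n A B"
  shows "char_poly A = char_poly B"
proof -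
  let ?A = "map_mat rat_of_int A" and ?B = "map_mat rat_of_int B"
  obtain C where C: "C \<in> carrier_mat n n" "invertible_mat C" and comm: "?A * C = C * ?B"
    using sim unfolding rat_similar_def GL_rat_def by auto
  obtain D where CD: "C * D = 1\<^sub>m n" and DC: "D * C = 1\<^sub>m (dim_row D)"
    using C unfolding invertible_mat_def inverts_mat_def by auto
  have D: "D \<in> carrier_mat n n"
    using arg_cong[OF CD, of dim_col] arg_cong[OF DC, of dim_col] C by auto
  have "?A = ?A * (C * D)" using A unfolding CD by simp
  also have "\<dots> = C * ?B * D" using A C D comm assoc_mult_mat[of ?A n n C n D n] by simp
  finally have "similar_mat ?A ?B"
    using A B C D CD DC by (intro similar_matI[where n = n and P = C and Q = D]) auto
  hence "char_poly ?A = char_poly ?B" by (rule char_poly_similar)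
  hence "map_poly rat_of_int (char_poly A) = map_poly rat_of_int (char_poly B)"
    unfolding of_int_hom.char_poly_hom[OF A] of_int_hom.char_poly_hom[OF B] .
  thus ?thesis by (simp add: poly_eq_iff coeff_map_poly)
qed

section \<open>Cyclic submodules\<close>

text \<open>The annihilator of \<open>m\<close> in \<open>\<int>[x]\<close> contains \<open>p\<close>. Let \<open>g \<noteq> 0\<close> be an annihilating polynomial of least
  degree. Pseudo-division of \<open>p\<close> by \<open>g\<close> leaves an annihilating remainder, which minimality forces to
  be \<open>0\<close>, so \<open>g\<close> divides \<open>a p\<close> for an integer \<open>a \<noteq> 0\<close>. As \<open>p\<close> is prime, either \<open>p\<close> divides
  \<open>g\<close> and no annihilating polynomial has smaller degree than \<open>p\<close>, or \<open>g\<close> is an integer constant,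
  which cannot annihilate a nonzero vector of \<open>\<int>\<^sup>n\<close>.\<close>
lemma poly_mat_annihilator_eq_0:
  fixes p :: "int poly"
  assumes A: "A \<in> carrier_mat n n" and m: "m \<in> carrier_vec n" "m \<noteq> 0\<^sub>v n"
    and p: "Factorial_Ring.irreducible p" "poly_mat p A = 0\<^sub>m n n"
    and f: "m \<^sub>r* poly_mat f A = 0\<^sub>v n" "degree f < degree p"
  shows "f = 0"
proof (rule ccontr)
  assume "f \<noteq> 0"
  define ann where "ann g \<longleftrightarrow> g \<noteq> 0 \<and> m \<^sub>r* poly_mat g A = 0\<^sub>v n" for g
  have "ann f" using \<open>f \<noteq> 0\<close> f(1) by (simp add: ann_def)
  then obtain g where g: "ann g" and least: "\<And>h. ann h \<Longrightarrow> degree g \<le> degree h"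
    using ex_has_least_nat[of ann f degree] by blast
  have "g \<noteq> 0" using g by (simp add: ann_def)
  have mg: "m \<^sub>r* poly_mat (g * h) A = 0\<^sub>v n" for h
    using g row_mult_assoc[OF m(1) poly_mat_carrier[OF A, of g] poly_mat_carrier[OF A, of h]] A
    by (simp add: ann_def poly_mat_mult)
  obtain a q where a: "a \<noteq> 0" and div: "Polynomial.smult a p = g * q + pseudo_mod p g"
    using pseudo_mod(1)[OF \<open>g \<noteq> 0\<close>, of p] by blast
  have "poly_mat (Polynomial.smult a p) A = 0\<^sub>m n n"
    using A p(2) by (intro eq_matI) (auto simp: poly_mat_smult[OF A])
  hence "m \<^sub>r* poly_mat (g * q) A + m \<^sub>r* poly_mat (pseudo_mod p g) A = 0\<^sub>v n"
    using m(1) A row_mult_add_right[OF m(1) poly_mat_carrier[OF A, of "g * q"]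
        poly_mat_carrier[OF A, of "pseudo_mod p g"]]
    by (simp add: poly_mat_add[OF A, symmetric] div[symmetric])
  hence "m \<^sub>r* poly_mat (pseudo_mod p g) A = 0\<^sub>v n"
    using mg[of q] row_mult_carrier[OF poly_mat_carrier[OF A, of "pseudo_mod p g"], of m] by simp
  moreover have "\<not> ann (pseudo_mod p g)" if "pseudo_mod p g \<noteq> 0"
    using pseudo_mod(2)[OF \<open>g \<noteq> 0\<close>, of p] that least by fastforce
  ultimately have "pseudo_mod p g = 0" by (auto simp: ann_def)
  with div have gq: "Polynomial.smult a p = g * q" by simp
  have "prime_elem p" using p(1) by (rule irreducible_imp_prime_elem_gcd)
  moreover have "p dvd g * q" unfolding gq[symmetric] by (simp add: dvd_smult)
  ultimately consider "p dvd g" | "p dvd q" using prime_elem_dvd_multD by blast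
  thus False
  proof cases
    case 1
    hence "degree p \<le> degree g" using \<open>g \<noteq> 0\<close> by (rule dvd_imp_degree_le)
    with least[OF \<open>ann f\<close>] f(2) show False by simp
  next
    case 2
    then obtain h where h: "q = p * h" by (auto simp: dvd_def)
    have "p * [:a:] = p * (g * h)" using gq unfolding h by (simp add: ac_simps)
    moreover have "p \<noteq> 0" using p(1) by auto
    ultimately have gh: "g * h = [:a:]" by (metis mult_cancel_left)
    hence "h \<noteq> 0" using a by auto
    hence "degree g = 0" using arg_cong[OF gh, of degree] \<open>g \<noteq> 0\<close> by (simp add: degree_mult_eq)
    then obtain b where b: "g = [:b:]" by (rule degree_eq_zeroE)
    have "b \<cdot>\<^sub>v m = 0\<^sub>v n"
      using g m(1) A by (simp add: b ann_def poly_mat_const row_mult_smult_one)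
    hence "b * m $ i = 0" if "i < n" for i
      using that m(1) by (metis carrier_vecD index_smult_vec(1) index_zero_vec(1))
    hence "m = 0\<^sub>v n" using m(1) b \<open>g \<noteq> 0\<close> by (intro eq_vecI) auto
    with m(2) show False ..
  qed
qed

text \<open>The rows \<open>m, mA, \<dots>, mA\<^sup>n\<^sup>-\<^sup>1\<close> form a matrix \<open>M\<close>, and the integer combinations \<open>cM\<close> of them are the
  vectors \<open>m f(A)\<close> with \<open>f\<close> of degree less than \<open>n\<close>. So a vector in the left kernel of \<open>M\<close> gives an
  annihilating polynomial of too small a degree, which shows \<open>det M \<noteq> 0\<close>, and
  \<open>w adj(M) M = det(M) w\<close> exhibits the multiples.\<close>
lemma cyclic_submodule_contains_multiples:
  fixes p :: "int poly"
  assumes A: "A \<in> carrier_mat n n" and m: "m \<in> carrier_vec n" "m \<noteq> 0\<^sub>v n"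
    and p: "Factorial_Ring.irreducible p" "poly_mat p A = 0\<^sub>m n n" "n \<le> degree p"
  obtains d :: int where "d > 0" "\<And>w. w \<in> carrier_vec n \<Longrightarrow> \<exists>f. m \<^sub>r* poly_mat f A = d \<cdot>\<^sub>v w"
proof -
  define M where "M = Matrix.mat n n (\<lambda>(i, j). (m \<^sub>r* A ^\<^sub>m i) $ j)"
  define F :: "int vec \<Rightarrow> int poly" where "F c = Poly (list_of_vec c)" for c
  have M: "M \<in> carrier_mat n n" by (simp add: M_def)
  have coeff_F: "coeff (F c) i = (if i < n then c $ i else 0)" if "c \<in> carrier_vec n" for c i
    using that by (auto simp: F_def nth_default_def list_of_vec_index)
  have FM: "m \<^sub>r* poly_mat (F c) A = c \<^sub>r* M" if c: "c \<in> carrier_vec n" for c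
  proof (intro eq_vecI)
    fix j assume "j < dim_vec (c \<^sub>r* M)"
    hence j: "j < n" using M by (simp add: row_mult_def)
    have Ad: "A ^\<^sub>m i \<in> carrier_mat n n" for i using A by simp
    have deg: "degree (F c) \<le> n" by (rule degree_le) (simp add: coeff_F[OF c])
    have "(m \<^sub>r* poly_mat (F c) A) $ j = (\<Sum>k<n. m $ k * poly_mat (F c) A $$ (k, j))"
      using A j m(1) by (auto simp: row_mult_def scalar_prod_def atLeast0LessThan)
    also have "\<dots> = (\<Sum>k<n. \<Sum>i\<le>n. m $ k * (coeff (F c) i * (A ^\<^sub>m i) $$ (k, j)))"
      using j by (intro sum.cong) (auto simp: poly_mat_index[OF A _ _ deg] sum_distrib_left)
    also have "\<dots> = (\<Sum>i\<le>n. coeff (F c) i * (\<Sum>k<n. m $ k * (A ^\<^sub>m i) $$ (k, j)))"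
      by (subst sum.swap) (simp add: sum_distrib_left ac_simps)
    also have "\<dots> = (\<Sum>i<n. c $ i * (\<Sum>k<n. m $ k * (A ^\<^sub>m i) $$ (k, j)))"
      by (intro sum.mono_neutral_cong_right) (auto simp: coeff_F[OF c])
    also have "\<dots> = (\<Sum>i<n. c $ i * M $$ (i, j))"
    proof (intro sum.cong refl arg_cong2[where f = "(*)"])
      fix i assume "i \<in> {..<n}"
      thus "(\<Sum>k<n. m $ k * (A ^\<^sub>m i) $$ (k, j)) = M $$ (i, j)"
        using j Ad[of i] m(1) A by (auto simp: M_def row_mult_def scalar_prod_def atLeast0LessThan)
    qed
    also have "\<dots> = (c \<^sub>r* M) $ j"
      using j M by (auto simp: row_mult_def scalar_prod_def atLeast0LessThan)
    finally show "(m \<^sub>r* poly_mat (F c) A) $ j = (c \<^sub>r* M) $ j" .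
  qed (use A M in \<open>simp add: row_mult_def\<close>)
  have "det M \<noteq> 0"
  proof
    assume "det M = 0"
    hence "det (transpose_mat M) = 0" using det_transpose[OF M] by simp
    then obtain c where c: "c \<in> carrier_vec n" "c \<noteq> 0\<^sub>v n" "transpose_mat M *\<^sub>v c = 0\<^sub>v n"
      using det_0_iff_vec_prod_zero[of "transpose_mat M" n] M by auto
    then obtain i where i: "i < n" "c $ i \<noteq> 0" by (metis carrier_vecD eq_vecI index_zero_vec)
    have "degree (F c) < n" using i by (intro degree_lessI) (auto simp: coeff_F[OF c(1)])
    moreover have "m \<^sub>r* poly_mat (F c) A = 0\<^sub>v n"
      using c M by (simp add: FM row_mult_eq_transpose[of _ n])
    ultimately have "F c = 0" using poly_mat_annihilator_eq_0[OF A m p(1,2)] p(3) by simp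
    with i show False using coeff_F[OF c(1), of i] by simp
  qed
  show ?thesis
  proof (rule that)
    show "\<bar>det M\<bar> > 0" using \<open>det M \<noteq> 0\<close> by simp
    fix w :: "int vec" assume w: "w \<in> carrier_vec n"
    \<comment> \<open>The sign turns \<open>det M\<close> into its absolute value.\<close>
    let ?c = "(sgn (det M) \<cdot>\<^sub>v w) \<^sub>r* adj_mat M"
    note adj = adj_mat[OF M]
    have "?c \<^sub>r* M = (sgn (det M) \<cdot>\<^sub>v w) \<^sub>r* (det M \<cdot>\<^sub>m 1\<^sub>m n)"
      using w adj M by (simp add: row_mult_assoc[of _ n])
    also have "\<dots> = \<bar>det M\<bar> \<cdot>\<^sub>v w"
      using w by (simp add: row_mult_smult_one smult_smult_assoc abs_sgn mult.commute)
    finally show "\<exists>f. m \<^sub>r* poly_mat f A = \<bar>det M\<bar> \<cdot>\<^sub>v w"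
      using FM[of ?c] adj(1) by auto
  qed
qed


section \<open>The finite quotients\<close>

text \<open>Writing \<open>A\<^sup>k\<^sup>! - I\<close> as a polynomial in \<open>A\<close> reduces the closure properties of \<open>N\<^sub>k\<close> to
  commutativity of, and divisibility in, \<open>\<int>[x]\<close>.\<close>
lemma N_sub_eq_poly_mat:
  assumes A: "A \<in> carrier_mat n n"
  shows "N_sub k A = (\<lambda>m. m \<^sub>r* poly_mat (Polynomial.monom 1 (fact k) - 1) A) ` carrier_vec n"
  using A unfolding N_sub_def by (simp add: poly_mat_monom_minus_one[OF A] module_vec_simps)

lemma abelian_group_Z_vec: "abelian_group (module_vec TYPE(int) n)"
  by unfold_locales (use add_inv_exists_vec in \<open>auto simp: module_vec_def Units_def\<close>)

lemma a_inv_Z_vec: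
  assumes "v \<in> carrier_vec n"
  shows "\<ominus>\<^bsub>module_vec TYPE(int) n\<^esub> v = - v"
proof -
  interpret abelian_group "module_vec TYPE(int) n" by (rule abelian_group_Z_vec)
  show ?thesis
    using assms by (intro minus_equality) (auto simp: module_vec_simps)
qed

lemma N_sub_abelian_subgroup:
  assumes A: "A \<in> carrier_mat n n"
  shows "abelian_subgroup (N_sub k A) (Z_vec A)"
proof (rule abelian_subgroupI3)
  let ?P = "poly_mat (Polynomial.monom 1 (fact k) - 1) A"
  have dim: "dim_row A = n" using A by simp
  have P: "?P \<in> carrier_mat n n" using A by simp
  show "abelian_group (Z_vec A)" by (rule abelian_group_Z_vec)
  interpret abelian_group "module_vec TYPE(int) n" by (rule abelian_group_Z_vec)
  show "additive_subgroup (N_sub k A) (Z_vec A)"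
    unfolding additive_subgroup_def dim
  proof (rule add.subgroupI; (simp only: monoid_record_simps)?)
    show "N_sub k A \<subseteq> carrier (module_vec TYPE(int) n)"
      using P by (auto simp: N_sub_eq_poly_mat[OF A] module_vec_simps)
    show "N_sub k A \<noteq> {}"
      unfolding N_sub_eq_poly_mat[OF A] using zero_carrier_vec[of n] by blast
  next
    fix a assume "a \<in> N_sub k A"
    then obtain m where m: "m \<in> carrier_vec n" "a = m \<^sub>r* ?P" by (auto simp: N_sub_eq_poly_mat[OF A])
    have "- a = (- 1 \<cdot>\<^sub>v m) \<^sub>r* ?P"
      unfolding row_mult_smult_left[OF m(1) P] m(2) by (intro eq_vecI) auto
    hence "- a \<in> N_sub k A" using m(1) by (auto simp: N_sub_eq_poly_mat[OF A])
    thus "\<ominus>\<^bsub>module_vec TYPE(int) n\<^esub> a \<in> N_sub k A"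
      using m P by (simp add: a_inv_Z_vec)
  next
    fix a b assume "a \<in> N_sub k A" "b \<in> N_sub k A"
    then obtain m m' where m: "m \<in> carrier_vec n" "a = m \<^sub>r* ?P" "m' \<in> carrier_vec n" "b = m' \<^sub>r* ?P"
      by (auto simp: N_sub_eq_poly_mat[OF A])
    have "a + b = (m + m') \<^sub>r* ?P" using m P by (simp add: row_mult_add_left)
    thus "a \<oplus>\<^bsub>module_vec TYPE(int) n\<^esub> b \<in> N_sub k A"
      using m by (auto simp: N_sub_eq_poly_mat[OF A] module_vec_simps)
  qed
qed

text \<open>\<open>f(A)\<close> commutes with \<open>A\<^sup>k\<^sup>! - I\<close>.\<close>
lemma N_sub_poly_mat_closed:
  assumes A: "A \<in> carrier_mat n n" and v: "v \<in> N_sub k A"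
  shows "v \<^sub>r* poly_mat f A \<in> N_sub k A"
proof -
  let ?g = "Polynomial.monom 1 (fact k) - 1 :: int poly"
  obtain m where m: "m \<in> carrier_vec n" "v = m \<^sub>r* poly_mat ?g A"
    using v by (auto simp: N_sub_eq_poly_mat[OF A])
  have "v \<^sub>r* poly_mat f A = (m \<^sub>r* poly_mat f A) \<^sub>r* poly_mat ?g A"
    using m A by (simp add: row_mult_assoc[of _ n] poly_mat_mult[OF A, symmetric] mult.commute)
  thus ?thesis using m A by (auto simp: N_sub_eq_poly_mat[OF A])
qed

text \<open>Since \<open>l!\<close> divides \<open>k!\<close>, the polynomial \<open>x\<^sup>l\<^sup>! - 1\<close> divides \<open>x\<^sup>k\<^sup>! - 1\<close>.\<close>
lemma N_sub_antimono:
  assumes A: "A \<in> carrier_mat n n" and "l \<le> k"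
  shows "N_sub k A \<subseteq> N_sub l A"
proof
  fix v assume "v \<in> N_sub k A"
  then obtain m where m: "m \<in> carrier_vec n" "v = m \<^sub>r* poly_mat (Polynomial.monom 1 (fact k) - 1) A"
    by (auto simp: N_sub_eq_poly_mat[OF A])
  obtain c :: nat where c: "fact k = fact l * c" using fact_dvd[OF \<open>l \<le> k\<close>, where 'a = nat] by (auto simp: dvd_def)
  have "(Polynomial.monom 1 (fact k) - 1 :: int poly) = Polynomial.monom 1 (fact l) ^ c - 1"
    by (simp add: c monom_power)
  also have "\<dots> = (\<Sum>i<c. Polynomial.monom 1 (fact l) ^ i) * (Polynomial.monom 1 (fact l) - 1)"
    by (simp add: power_diff_1_eq mult.commute)
  finally have "v = (m \<^sub>r* poly_mat (\<Sum>i<c. Polynomial.monom 1 (fact l) ^ i) A)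
      \<^sub>r* poly_mat (Polynomial.monom 1 (fact l) - 1) A"
    using m A by (simp add: row_mult_assoc[of _ n] poly_mat_mult)
  thus "v \<in> N_sub l A" using m A by (auto simp: N_sub_eq_poly_mat[OF A])
qed

lemma in_coset_of_iff:
  assumes A: "A \<in> carrier_mat n n" and "m \<in> carrier_vec n" "v \<in> carrier_vec n"
  shows "v \<in> coset_of k A m \<longleftrightarrow> v - m \<in> N_sub k A"
proof -
  interpret abelian_subgroup "N_sub k A" "Z_vec A" by (rule N_sub_abelian_subgroup[OF A])
  have "v - m = v + - m" using assms(2,3) by (intro eq_vecI) auto
  thus ?thesis
    using a_rcos_module[of m v] assms by (simp add: coset_of_def module_vec_simps a_inv_Z_vec)
qed

lemma coset_of_subset: "A \<in> carrier_mat n n \<Longrightarrow> m \<in> carrier_vec n \<Longrightarrow> coset_of k A m \<subseteq> carrier_vec n"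
  using abelian_subgroup.a_rcosets_carrier[OF N_sub_abelian_subgroup, of A n "coset_of k A m" k]
  by (auto simp: coset_of_def A_RCOSETS_def' module_vec_simps)

lemma self_in_coset_of:
  "A \<in> carrier_mat n n \<Longrightarrow> m \<in> carrier_vec n \<Longrightarrow> m \<in> coset_of k A m"
  using abelian_subgroup.a_rcos_self[OF N_sub_abelian_subgroup, of A n m k]
  by (simp add: coset_of_def module_vec_simps)

lemma coset_of_eqI:
  assumes A: "A \<in> carrier_mat n n" and "m \<in> carrier_vec n" "v \<in> carrier_vec n" "v - m \<in> N_sub k A"
  shows "coset_of k A v = coset_of k A m"
proof -
  interpret abelian_subgroup "N_sub k A" "Z_vec A" by (rule N_sub_abelian_subgroup[OF A])
  show ?thesis
    using a_repr_independence'[of v m] in_coset_of_iff[OF assms(1-3), of k] assms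
    by (simp add: coset_of_def module_vec_simps)
qed

lemma coset_of_add:
  assumes A: "A \<in> carrier_mat n n" and "m \<in> carrier_vec n" "v \<in> carrier_vec n"
  shows "coset_of k A m \<oplus>\<^bsub>G_fin k A\<^esub> coset_of k A v = coset_of k A (m + v)"
proof -
  interpret abelian_subgroup "N_sub k A" "Z_vec A" by (rule N_sub_abelian_subgroup[OF A])
  show ?thesis
    using a_rcos_sum[of m v] assms by (simp add: coset_of_def G_fin_def module_vec_simps)
qed

lemma coset_of_zero:
  assumes A: "A \<in> carrier_mat n n"
  shows "coset_of k A (0\<^sub>v n) = \<zero>\<^bsub>G_fin k A\<^esub>"
proof -
  interpret abelian_subgroup "N_sub k A" "Z_vec A" by (rule N_sub_abelian_subgroup[OF A])
  have "0\<^sub>v n \<in> N_sub k A" using A additive_subgroup.zero_closed[OF is_additive_subgroup] by (simp add: module_vec_simps)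
  thus ?thesis by (simp add: coset_of_def G_fin_def a_rcos_const)
qed

lemma carrier_G_fin:
  "A \<in> carrier_mat n n \<Longrightarrow> carrier (G_fin k A) = coset_of k A ` carrier_vec n"
  by (auto simp: G_fin_def A_RCOSETS_def' coset_of_def module_vec_simps)

lemma transition_coset_of:
  assumes A: "A \<in> carrier_mat n n" and m: "m \<in> carrier_vec n" and "l \<le> k"
  shows "transition k l A (coset_of k A m) = coset_of l A m"
proof -
  have "coset_of l A v = coset_of l A m" if v: "v \<in> coset_of k A m" for v
  proof (rule coset_of_eqI[OF A m])
    show v': "v \<in> carrier_vec n" using v coset_of_subset[OF A m] by blast
    show "v - m \<in> N_sub l A"
      using v in_coset_of_iff[OF A m v'] N_sub_antimono[OF A \<open>l \<le> k\<close>] by blast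
  qed
  thus ?thesis using self_in_coset_of[OF A m, of k] unfolding transition_def by blast
qed

abbreviation poly_class :: "int poly \<Rightarrow> int poly \<Rightarrow> int poly set" where
  "poly_class p f \<equiv> PIdl\<^bsub>(class_ring :: int poly ring)\<^esub> p +>\<^bsub>(class_ring :: int poly ring)\<^esub> f"

lemma poly_class_eq: "poly_class p f = {h * p + f |h. True}"
  by (auto simp: a_r_coset_def' cgenideal_def)

lemma poly_class_in_carrier: "poly_class p f \<in> carrier (quot_poly_ring p)"
  by (auto simp: quot_poly_ring_def FactRing_def A_RCOSETS_def')

text \<open>The scalar product is a union over all representatives of \<open>f + (p)\<close> and of the coset of \<open>m\<close>.
  A multiple of \<open>p\<close> evaluates to \<open>0\<close> at \<open>A\<close>, and \<open>N\<^sub>k\<close> is stable under \<open>f(A)\<close>, so every member of this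
  union is the same coset.\<close>
lemma smult_coset_of:
  assumes A: "A \<in> carrier_mat n n" and m: "m \<in> carrier_vec n" and p: "poly_mat p A = 0\<^sub>m n n"
  shows "poly_class p f \<odot>\<^bsub>G_fin k A\<^esub> coset_of k A m = coset_of k A (m \<^sub>r* poly_mat f A)"
proof -
  have same: "coset_of k A (v \<^sub>r* poly_mat g A) = coset_of k A (m \<^sub>r* poly_mat f A)"
    if g: "g \<in> poly_class p f" and v: "v \<in> coset_of k A m" for g v
  proof (rule coset_of_eqI[OF A])
    have v': "v \<in> carrier_vec n" using v coset_of_subset[OF A m] by blast
    obtain h where "g = h * p + f" using g unfolding poly_class_eq by blast
    moreover have "poly_mat h A * 0\<^sub>m n n = 0\<^sub>m n n"
      by (rule right_mult_zero_mat[OF poly_mat_carrier[OF A]])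
    ultimately have gf: "poly_mat g A = poly_mat f A"
      using A p by (simp add: poly_mat_add poly_mat_mult left_add_zero_mat[OF poly_mat_carrier[OF A]])
    have "v \<^sub>r* poly_mat g A - m \<^sub>r* poly_mat f A = (v - m) \<^sub>r* poly_mat f A"
      using row_mult_diff_left[OF v' m poly_mat_carrier[OF A]] by (simp add: gf)
    moreover have "v - m \<in> N_sub k A" using v in_coset_of_iff[OF A m v'] by simp
    ultimately show "v \<^sub>r* poly_mat g A - m \<^sub>r* poly_mat f A \<in> N_sub k A"
      using N_sub_poly_mat_closed[OF A] by simp
  qed (use A in auto)
  have "f \<in> poly_class p f" unfolding poly_class_eq by (auto intro: exI[of _ 0])
  moreover have "poly_class p f \<odot>\<^bsub>G_fin k A\<^esub> coset_of k A m
      = (\<Union>g\<in>poly_class p f. \<Union>v\<in>coset_of k A m. coset_of k A (v \<^sub>r* poly_mat g A))"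
    by (simp add: G_fin_def)
  ultimately show ?thesis using same self_in_coset_of[OF A m, of k] by blast
qed

section \<open>The profinite module\<close>

lemma iota_in_carrier:
  assumes A: "A \<in> carrier_mat n n" and m: "m \<in> carrier_vec n"
  shows "iota A m \<in> carrier (G_lim A)"
  using m by (auto simp: G_lim_def iota_def carrier_G_fin[OF A] transition_coset_of[OF A m])

lemma iota_zero: "A \<in> carrier_mat n n \<Longrightarrow> iota A (0\<^sub>v n) = \<zero>\<^bsub>G_lim A\<^esub>"
  by (simp add: G_lim_def iota_def coset_of_zero cong: restrict_cong)

lemma iota_add:
  assumes "A \<in> carrier_mat n n" "m \<in> carrier_vec n" "v \<in> carrier_vec n"
  shows "iota A m \<oplus>\<^bsub>G_lim A\<^esub> iota A v = iota A (m + v)"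
  using assms by (simp add: G_lim_def iota_def coset_of_add[OF assms] cong: restrict_cong)

lemma smult_iota:
  assumes "A \<in> carrier_mat n n" "m \<in> carrier_vec n" "poly_mat p A = 0\<^sub>m n n"
  shows "poly_class p f \<odot>\<^bsub>G_lim A\<^esub> iota A m = iota A (m \<^sub>r* poly_mat f A)"
  using assms by (simp add: G_lim_def iota_def smult_coset_of[OF assms] cong: restrict_cong)

text \<open>Linearity over \<open>R\<close> gives \<open>\<Psi> 0 = 0\<close> through the scalar \<open>0\<close>; the value of \<open>\<Psi>\<close> is at first an
  arbitrary \<open>g\<close>, not known to lie in the image of \<open>\<int>\<^sup>n\<close>.\<close>
lemma smult_zero_class:
  assumes A: "A \<in> carrier_mat n n" and p: "poly_mat p A = 0\<^sub>m n n" and g: "g \<in> carrier (G_lim A)"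
  shows "poly_class p 0 \<odot>\<^bsub>G_lim A\<^esub> g = \<zero>\<^bsub>G_lim A\<^esub>"
proof -
  have "poly_class p 0 \<odot>\<^bsub>G_fin k A\<^esub> g k = \<zero>\<^bsub>G_fin k A\<^esub>" if "k \<ge> 1" for k
  proof -
    have "g k \<in> carrier (G_fin k A)" using g that by (auto simp: G_lim_def)
    then obtain v where "v \<in> carrier_vec n" "g k = coset_of k A v" by (auto simp: carrier_G_fin[OF A])
    thus ?thesis using A p by (simp add: smult_coset_of coset_of_zero)
  qed
  thus ?thesis by (simp add: G_lim_def cong: restrict_cong)
qed

section \<open>Trivial intersection or finite index\<close>

text \<open>Adding an element of \<open>\<iota>\<^sub>B(d\<int>\<^sup>n)\<close> does not change a coset of \<open>H\<close>, so the representatives with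
  entries in \<open>{0..<d}\<close> meet all cosets.\<close>
lemma finite_index_if_contains_multiples:
  assumes B: "B \<in> carrier_mat n n" and H: "H \<subseteq> iota_image B"
    and add: "\<And>x y. x \<in> H \<Longrightarrow> y \<in> H \<Longrightarrow> x \<oplus>\<^bsub>G_lim B\<^esub> y \<in> H"
    and d: "(d::int) > 0" "\<And>w. w \<in> carrier_vec n \<Longrightarrow> iota B (d \<cdot>\<^sub>v w) \<in> H"
  shows "finite_index (G_lim B) H (iota_image B)"
proof -
  \<comment> \<open>\<open>T v\<close> is the coset of \<open>\<iota>\<^sub>B(v)\<close>.\<close>
  define T where "T v = (\<Union>h\<in>H. {h \<oplus>\<^bsub>G_lim B\<^esub> iota B v})" for v
  define box where "box = {v \<in> carrier_vec n. \<forall>i<n. v $ i \<in> {0..<d}}"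
  have T_mono: "T (v + d \<cdot>\<^sub>v w) \<subseteq> T v" if v: "v \<in> carrier_vec n" and w: "w \<in> carrier_vec n" for v w
  proof
    fix x assume "x \<in> T (v + d \<cdot>\<^sub>v w)"
    then obtain h where h: "h \<in> H" "x = h \<oplus>\<^bsub>G_lim B\<^esub> iota B (v + d \<cdot>\<^sub>v w)" by (auto simp: T_def)
    then obtain m where m: "m \<in> carrier_vec n" "h = iota B m"
      using H B by (auto simp: iota_image_def module_vec_simps)
    have "m + (v + d \<cdot>\<^sub>v w) = (m + d \<cdot>\<^sub>v w) + v" using m v w by (intro eq_vecI) auto
    hence "x = (h \<oplus>\<^bsub>G_lim B\<^esub> iota B (d \<cdot>\<^sub>v w)) \<oplus>\<^bsub>G_lim B\<^esub> iota B v"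
      using h m v w by (simp add: iota_add[OF B])
    thus "x \<in> T v" using add[OF h(1) d(2)[OF w]] by (auto simp: T_def)
  qed
  have T_eq: "T (v + d \<cdot>\<^sub>v w) = T v" if v: "v \<in> carrier_vec n" and w: "w \<in> carrier_vec n" for v w
  proof
    have "v = (v + d \<cdot>\<^sub>v w) + d \<cdot>\<^sub>v (- w)" using v w by (intro eq_vecI) auto
    thus "T v \<subseteq> T (v + d \<cdot>\<^sub>v w)" using T_mono[of "v + d \<cdot>\<^sub>v w" "- w"] v w by simp
  qed (rule T_mono[OF that])
  have "T v \<in> T ` box" if v: "v \<in> carrier_vec n" for v
  proof -
    let ?r = "Matrix.vec n (\<lambda>i. v $ i mod d)" and ?q = "Matrix.vec n (\<lambda>i. v $ i div d)"
    have "v = ?r + d \<cdot>\<^sub>v ?q" using v by (intro eq_vecI) auto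
    hence "T v = T ?r" using T_eq[of ?r ?q] by simp
    moreover have "?r \<in> box" using d(1) by (auto simp: box_def)
    ultimately show ?thesis by blast
  qed
  moreover have "finite box"
  proof (rule finite_subset)
    show "box \<subseteq> Matrix.vec n ` (\<Pi>\<^sub>E i\<in>{..<n}. {0..<d})"
    proof
      fix v assume v: "v \<in> box"
      have "v = Matrix.vec n (restrict (($) v) {..<n})" using v by (intro eq_vecI) (auto simp: box_def)
      moreover have "restrict (($) v) {..<n} \<in> (\<Pi>\<^sub>E i\<in>{..<n}. {0..<d})" using v by (auto simp: box_def)
      ultimately show "v \<in> Matrix.vec n ` (\<Pi>\<^sub>E i\<in>{..<n}. {0..<d})" by blast
    qed
  qed (simp add: finite_PiE)
  ultimately have "finite (T ` carrier_vec n)" by (metis finite_imageI finite_subset image_subsetI)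
  moreover have "a_rcosets\<^bsub>G_lim B\<lparr>carrier := iota_image B\<rparr>\<^esub> H = T ` carrier_vec n"
    using B by (auto simp: A_RCOSETS_def' a_r_coset_def' T_def iota_image_def module_vec_simps)
  ultimately show ?thesis unfolding finite_index_def by simp
qed

theorem theorem7p1:
  fixes n :: nat and A B :: "int mat"
    and \<Psi> :: "(nat \<Rightarrow> int vec set) \<Rightarrow> (nat \<Rightarrow> int vec set)"
  assumes "A \<in> GL_int n" and "B \<in> GL_int n"
    and "rat_similar n A B"
    and "hyperbolic_mat A" and "hyperbolic_mat B"
    and "irreducible_mat A" and "irreducible_mat B"
    and "top_module_iso (quot_poly_ring (char_poly A)) (G_lim A) (G_top A) (G_lim B) (G_top B) \<Psi>"
  shows "\<Psi> ` iota_image A \<inter> iota_image B = {\<zero>\<^bsub>G_lim B\<^esub>} \<or>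
         finite_index (G_lim B) (\<Psi> ` iota_image A \<inter> iota_image B) (iota_image B)"
proof -
  let ?p = "char_poly A" and ?H = "\<Psi> ` iota_image A \<inter> iota_image B"
  have A: "A \<in> carrier_mat n n" and B: "B \<in> carrier_mat n n"
    using assms(1,2) by (auto simp: GL_int_def)
  have pA: "poly_mat ?p A = 0\<^sub>m n n" by (rule cayley_hamilton[OF A])
  have pB: "poly_mat ?p B = 0\<^sub>m n n"
    using cayley_hamilton[OF B] char_poly_eq_if_rat_similar[OF A B assms(3)] by simp
  have hom: "\<Psi> \<in> LinearCombinations.module_hom (quot_poly_ring ?p) (G_lim A) (G_lim B)"
    using assms(8) by (simp add: top_module_iso_def)
  note \<Psi>_add = LinearCombinations.module_hom_add[OF hom]
    and \<Psi>_smult = LinearCombinations.module_hom_smult[OF hom poly_class_in_carrier]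
    and \<Psi>_closed = LinearCombinations.module_hom_closed[OF hom]
  have im: "iota_image M = iota M ` carrier_vec n" if "M \<in> carrier_mat n n" for M
    using that by (simp add: iota_image_def module_vec_simps)
  have H_iff: "x \<in> ?H \<longleftrightarrow> (\<exists>a\<in>carrier_vec n. \<exists>b\<in>carrier_vec n. x = iota B b \<and> \<Psi> (iota A a) = x)" for x
    unfolding im[OF A] im[OF B] by (simp add: image_image image_iff) metis
  have zero: "\<zero>\<^bsub>G_lim B\<^esub> \<in> ?H"
  proof -
    have in_A: "iota A (0\<^sub>v n) \<in> carrier (G_lim A)" by (rule iota_in_carrier[OF A]) simp
    have "\<Psi> (iota A (0\<^sub>v n)) = \<Psi> (poly_class ?p 0 \<odot>\<^bsub>G_lim A\<^esub> iota A (0\<^sub>v n))"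
      using smult_zero_class[OF A pA in_A] iota_zero[OF A] by simp
    also have "\<dots> = poly_class ?p 0 \<odot>\<^bsub>G_lim B\<^esub> \<Psi> (iota A (0\<^sub>v n))" by (rule \<Psi>_smult[OF in_A])
    also have "\<dots> = \<zero>\<^bsub>G_lim B\<^esub>"
      using \<Psi>_closed in_A by (intro smult_zero_class[OF B pB]) auto
    finally show ?thesis
      unfolding H_iff using iota_zero[OF B] zero_carrier_vec by metis
  qed
  show ?thesis
  proof (cases "?H = {\<zero>\<^bsub>G_lim B\<^esub>}")
    case False
    then obtain h where h: "h \<in> ?H" "h \<noteq> \<zero>\<^bsub>G_lim B\<^esub>" using zero by blast
    then obtain a m where a: "a \<in> carrier_vec n" and m: "m \<in> carrier_vec n"
      and hm: "h = iota B m" "\<Psi> (iota A a) = iota B m" unfolding H_iff by blast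
    have "m \<noteq> 0\<^sub>v n" using h(2) hm(1) iota_zero[OF B] by auto
    moreover have "Factorial_Ring.irreducible ?p" using assms(6) by (simp add: irreducible_mat_def)
    moreover have "n \<le> degree ?p" using degree_monic_char_poly[OF A] by simp
    ultimately obtain d :: int where d: "d > 0"
      "\<And>w. w \<in> carrier_vec n \<Longrightarrow> \<exists>f. m \<^sub>r* poly_mat f B = d \<cdot>\<^sub>v w"
      using cyclic_submodule_contains_multiples[OF B m _ _ pB] by blast
    have orbit: "iota B (m \<^sub>r* poly_mat f B) \<in> ?H" for f
    proof -
      have "\<Psi> (iota A (a \<^sub>r* poly_mat f A)) = poly_class ?p f \<odot>\<^bsub>G_lim B\<^esub> \<Psi> (iota A a)"
        unfolding smult_iota[OF A a pA, symmetric] by (rule \<Psi>_smult[OF iota_in_carrier[OF A a]])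
      also have "\<dots> = iota B (m \<^sub>r* poly_mat f B)"
        unfolding hm(2) by (rule smult_iota[OF B m pB])
      finally show ?thesis
        unfolding H_iff using A B row_mult_carrier poly_mat_carrier by metis
    qed
    have "finite_index (G_lim B) ?H (iota_image B)"
    proof (rule finite_index_if_contains_multiples[OF B _ _ d(1)])
      show "x \<oplus>\<^bsub>G_lim B\<^esub> y \<in> ?H" if x: "x \<in> ?H" and y: "y \<in> ?H" for x y
      proof -
        obtain a b where ab: "a \<in> carrier_vec n" "b \<in> carrier_vec n" "x = iota B b" "\<Psi> (iota A a) = iota B b"
          using x unfolding H_iff by blast
        obtain a' b' where ab': "a' \<in> carrier_vec n" "b' \<in> carrier_vec n" "y = iota B b'" "\<Psi> (iota A a') = iota B b'"
          using y unfolding H_iff by blast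
        have "\<Psi> (iota A (a + a')) = iota B (b + b')"
          using \<Psi>_add[OF iota_in_carrier[OF A ab(1)] iota_in_carrier[OF A ab'(1)]] ab ab'
          by (simp add: iota_add[OF A] iota_add[OF B])
        thus ?thesis
          unfolding H_iff using ab ab' by (metis add_carrier_vec iota_add[OF B])
      qed
      show "iota B (d \<cdot>\<^sub>v w) \<in> ?H" if "w \<in> carrier_vec n" for w
        using d(2)[OF that] orbit by metis
    qed blast
    thus ?thesis ..
  qed blast
qed

end
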